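(* With the scalars $a$, $d$, $\theta_i$, $t_i$ attached to the $\mathcal O_q$-module $V$ as described in the context, for $0\le r\le s\le d$, $$\frac{t_s}{t_r}=\sum_{i=0}^{s-r}\frac{a^iq^{i(d-2r)}(\theta_s-\theta_r)(\theta_s-\theta_{r+1})\cdots(\theta_s-\theta_{r+i-1})}{(q^2;q^2)_i},$$ $$\frac{t_r}{t_s}=\sum_{i=0}^{s-r}\frac{a^{-i}q^{i(2r-d)}(\theta_s-\theta_r)(\theta_s-\theta_{r+1})\cdots(\theta_s-\theta_{r+i-1})}{(q^{-2};q^{-2})_i}.$$
   Context: Setting. $\mathbb F$ is a field and $q\in\mathbb F$ is nonzero and not a root of unity. Algebras are associative, unital, over $\mathbb F$. Write $[X,Y]=XY-YX$, $[X,Y]_q=qXY-q^{-1}YX$, $[X,Y]_{q^{-1}}=q^{-1}XY-qYX$. The $q$-Onsager algebra $\mathcal O_q$ is defined by generators $A,A^*$ and relations $[A,[A,[A,A^*]_q]_{q^{-1}}]=(q^2-q^{-2})^2[A^*,A]$ and $[A^*,[A^*,[A^*,A]_q]_{q^{-1}}]=(q^2-q^{-2})^2[A,A^*]$. $V$ is an irreducible $\mathcal O_q$-module of finite dimension at least $2$ on which each of $A,A^*$ is diagonalizable. Scalars. The eigenvalues of $A$ on $V$ can be ordered as mutually distinct $\theta_0,\dots,\theta_d$ ($d\ge 1$) such that $\theta_i=aq^{d-2i}+a^{-1}q^{2i-d}$ ($0\le i\le d$) for some nonzero $a\in\mathbb F$; fix such an ordering and $a$. Let $t_{ij}=1+\frac{\theta_i-\theta_j}{q-q^{-1}}\cdot\frac{q\theta_i-q^{-1}\theta_j}{q^2-q^{-2}}$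 and $t_i=t_{01}t_{12}\cdots t_{i-1,i}$ ($0\le i\le d$, $t_0=1$); each $t_i$ is nonzero. Notation. $(z;t)_n=(1-z)(1-zt)\cdots(1-zt^{n-1})$ for $n\in\mathbb N=\{0,1,2,\dots\}$; empty products equal $1$. *)

theory Defs
  imports Complex_Main "HOL-Algebra.QuotRing" "HOL-Library.Poly_Mapping"
begin

section \<open>The free associative algebra on two generators\<close>

datatype onsager_gen = Gen_A | Gen_Astar

text \<open>Words in the generators, with concatenation written additively: the ring structure on
  finitely supported functions in \<^theory>\<open>HOL-Library.Poly_Mapping\<close> is the convolution product
  over an additive monoid, which is not required to be commutative.\<close>

datatype word = Word "onsager_gen list"

instantiation word :: monoid_add
begin

definition zero_word :: word where
  "zero_word = Word []"

fun plus_word :: "word \<Rightarrow> word \<Rightarrow> word" where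
  "plus_word (Word u) (Word v) = Word (u @ v)"

instance
proof
  fix u v w :: word
  show "u + v + w = u + (v + w)" by (cases u; cases v; cases w) simp
  show "0 + u = u" by (cases u) (simp add: zero_word_def)
  show "u + 0 = u" by (cases u) (simp add: zero_word_def)
qed

end

type_synonym 'f free_alg = "word \<Rightarrow>\<^sub>0 'f"

definition fa_scalar :: "'f::field \<Rightarrow> 'f free_alg" where
  "fa_scalar c = Poly_Mapping.single 0 c"

definition fa_gen :: "onsager_gen \<Rightarrow> 'f::field free_alg" where
  "fa_gen g = Poly_Mapping.single (Word [g]) 1"

definition fa_ring :: "'f::field free_alg ring" where
  "fa_ring = \<lparr>carrier = UNIV, mult = (*), one = 1, zero = 0, add = (+)\<rparr>"

section \<open>The q-Onsager algebra\<close>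

definition comm :: "'f::field free_alg \<Rightarrow> 'f free_alg \<Rightarrow> 'f free_alg" where
  "comm X Y = X * Y - Y * X"

definition qcomm :: "'f::field \<Rightarrow> 'f free_alg \<Rightarrow> 'f free_alg \<Rightarrow> 'f free_alg" where
  "qcomm q X Y = fa_scalar q * (X * Y) - fa_scalar (inverse q) * (Y * X)"

text \<open>The difference of the two sides of the first defining relation at \<open>(X, Y) = (A, A*)\<close>,
  and of the second one at \<open>(X, Y) = (A*, A)\<close>.\<close>

definition onsager_relator :: "'f::field \<Rightarrow> 'f free_alg \<Rightarrow> 'f free_alg \<Rightarrow> 'f free_alg" where
  "onsager_relator q X Y =
     comm X (qcomm (inverse q) X (qcomm q X Y))
     - fa_scalar ((q\<^sup>2 - inverse (q\<^sup>2))\<^sup>2) * comm Y X"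

text \<open>\<^const>\<open>genideal\<close> generates a two-sided ideal.\<close>

definition onsager_ideal :: "'f::field \<Rightarrow> 'f free_alg set" where
  "onsager_ideal q = genideal fa_ring
     {onsager_relator q (fa_gen Gen_A) (fa_gen Gen_Astar),
      onsager_relator q (fa_gen Gen_Astar) (fa_gen Gen_A)}"

definition Oq :: "'f::field \<Rightarrow> 'f free_alg set ring" where
  "Oq q = fa_ring Quot onsager_ideal q"

definition Oq_class :: "'f::field \<Rightarrow> 'f free_alg \<Rightarrow> 'f free_alg set" where
  "Oq_class q x = onsager_ideal q +>\<^bsub>fa_ring\<^esub> x"

abbreviation Oq_A :: "'f::field \<Rightarrow> 'f free_alg set" where
  "Oq_A q \<equiv> Oq_class q (fa_gen Gen_A)"

abbreviation Oq_Astar :: "'f::field \<Rightarrow> 'f free_alg set" where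
  "Oq_Astar q \<equiv> Oq_class q (fa_gen Gen_Astar)"

section \<open>Modules\<close>

text \<open>Left modules; the vector space \<open>V\<close> is the whole type \<open>'v\<close>. The action is unconstrained
  outside the carrier of the algebra.\<close>

locale Oq_module = vector_space scale
  for scale :: "'f::field \<Rightarrow> 'v::ab_group_add \<Rightarrow> 'v" +
  fixes q :: 'f and act :: "'f free_alg set \<Rightarrow> 'v \<Rightarrow> 'v"
  assumes act_add_right:
      "x \<in> carrier (Oq q) \<Longrightarrow> act x (v + w) = act x v + act x w"
    and act_add_left:
      "\<lbrakk>x \<in> carrier (Oq q); y \<in> carrier (Oq q)\<rbrakk> \<Longrightarrow>
        act (x \<oplus>\<^bsub>Oq q\<^esub> y) v = act x v + act y v"
    and act_mult:
      "\<lbrakk>x \<in> carrier (Oq q); y \<in> carrier (Oq q)\<rbrakk> \<Longrightarrow>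
        act (x \<otimes>\<^bsub>Oq q\<^esub> y) v = act x (act y v)"
    and act_one: "act \<one>\<^bsub>Oq q\<^esub> v = v"
    and act_scalar: "act (Oq_class q (fa_scalar c)) v = scale c v"
begin

definition submodule :: "'v set \<Rightarrow> bool" where
  "submodule W \<longleftrightarrow> subspace W \<and> (\<forall>x\<in>carrier (Oq q). \<forall>w\<in>W. act x w \<in> W)"

definition irreducible_module :: bool where
  "irreducible_module \<longleftrightarrow>
     (UNIV :: 'v set) \<noteq> {0} \<and> (\<forall>W. submodule W \<longrightarrow> W = {0} \<or> W = UNIV)"

end

context vector_space
begin

definition finite_dim :: bool where
  "finite_dim \<longleftrightarrow> (\<exists>B. finite B \<and> span B = UNIV)"

definition eigenvalues :: "('b \<Rightarrow> 'b) \<Rightarrow> 'a set" where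
  "eigenvalues f = {c. \<exists>v. v \<noteq> 0 \<and> f v = scale c v}"

text \<open>\<open>V\<close> is spanned by the eigenspaces of \<open>f\<close>.\<close>

definition diagonalizable :: "('b \<Rightarrow> 'b) \<Rightarrow> bool" where
  "diagonalizable f \<longleftrightarrow> span {v. \<exists>c. f v = scale c v} = UNIV"

end

section \<open>Scalars\<close>

definition qpoch :: "'f::field \<Rightarrow> 'f \<Rightarrow> nat \<Rightarrow> 'f" where
  "qpoch z t n = (\<Prod>k<n. 1 - z * t ^ k)"

definition t_pair :: "'f::field \<Rightarrow> (nat \<Rightarrow> 'f) \<Rightarrow> nat \<Rightarrow> nat \<Rightarrow> 'f" where
  "t_pair q \<theta> i j =
     1 + (\<theta> i - \<theta> j) / (q - inverse q)
       * ((q * \<theta> i - inverse q * \<theta> j) / (q\<^sup>2 - inverse (q\<^sup>2)))"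

definition t_scalar :: "'f::field \<Rightarrow> (nat \<Rightarrow> 'f) \<Rightarrow> nat \<Rightarrow> 'f" where
  "t_scalar q \<theta> i = (\<Prod>k<i. t_pair q \<theta> k (Suc k))"

end

theory Submission
  imports Defs
begin

text \<open>
  For \<open>\<theta>\<^sub>i = a q\<^bsup>d-2i\<^esup> + a\<^sup>-\<^sup>1 q\<^bsup>2i-d\<^esup>\<close> the scalar \<open>t\<^sub>k\<^sub>,\<^sub>k\<^sub>+\<^sub>1\<close> collapses to the monomial
  \<open>a\<^sup>2 q\<^bsup>2d-4k-2\<^esup>\<close>, so that \<open>t\<^sub>s / t\<^sub>r = (a\<^sup>2 q\<^bsup>2(d-r-s)\<^esup>)\<^bsup>s-r\<^esup>\<close> (lemma \<open>t_scalar_ratio\<close>). Both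
  claims thus evaluate a terminating \<open>q\<close>-series.

  Put \<open>p = q\<^sup>2\<close>, \<open>n = s - r\<close>, \<open>b = a q\<^bsup>d-2r\<^esup>\<close> and \<open>x = b\<^sup>2 p\<^bsup>-n\<^esup>\<close>. Then \<open>\<theta>\<^sub>s - \<theta>\<^sub>r\<^sub>+\<^sub>j\<close> factors, and
  \<open>b (\<theta>\<^sub>s - \<theta>\<^sub>r\<^sub>+\<^sub>j) = (1 - p\<^bsup>n-j\<^esup>) (x - p\<^sup>j)\<close>. The \<open>i\<close>-th summand of the first sum therefore is the
  Gaussian binomial coefficient \<open>n\<close> over \<open>i\<close> in base \<open>p\<close> times \<open>(x - 1)(x - p)\<cdots>(x - p\<^bsup>i-1\<^esup>)\<close>,
  and Cauchy's expansion of \<open>x\<^sup>n\<close> in these products (lemma \<open>cauchy_expansion\<close>) gives the sum the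
  value \<open>x\<^sup>n = t\<^sub>s / t\<^sub>r\<close>.

  The sequence \<open>\<theta>\<close> does not change under \<open>(a, q) \<mapsto> (a\<^sup>-\<^sup>1, q\<^sup>-\<^sup>1)\<close>, whereas the monomial \<open>t\<^sub>s / t\<^sub>r\<close>
  is inverted. Hence the second identity is the first one for the inverted parameters.
\<close>

section \<open>Gaussian binomial coefficients\<close>

text \<open>The product \<open>(p\<^bsup>n-i+1\<^esup>; p)\<^sub>i / (p; p)\<^sub>i\<close> is what the factorization of the summands yields. For
  \<open>i > n\<close> its factor at \<open>j = n\<close> is \<open>0\<close>, as it should be.\<close>

definition gauss_binomial :: "'f::field \<Rightarrow> nat \<Rightarrow> nat \<Rightarrow> 'f" where
  "gauss_binomial p n i = (\<Prod>j<i. (1 - p ^ (n - j)) / (1 - p ^ Suc j))"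

lemma gauss_binomial_0 [simp]: "gauss_binomial p n 0 = 1"
  by (simp add: gauss_binomial_def)

lemma gauss_binomial_Suc:
  "gauss_binomial p n (Suc i) = gauss_binomial p n i * ((1 - p ^ (n - i)) / (1 - p ^ Suc i))"
  by (simp add: gauss_binomial_def)

lemma gauss_binomial_eq_0: "n < i \<Longrightarrow> gauss_binomial p n i = 0"
  unfolding gauss_binomial_def by (rule prod_zero) (auto intro!: bexI[of _ n])

lemma gauss_binomial_Suc_Suc:
  "gauss_binomial p (Suc n) (Suc i) = gauss_binomial p n i * ((1 - p ^ Suc n) / (1 - p ^ Suc i))"
proof -
  have "gauss_binomial p (Suc n) (Suc i) =
      (\<Prod>j<Suc i. 1 - p ^ (Suc n - j)) / (\<Prod>j<Suc i. 1 - p ^ Suc j)"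
    by (simp only: gauss_binomial_def prod_dividef)
  also have "(\<Prod>j<Suc i. 1 - p ^ (Suc n - j)) = (1 - p ^ Suc n) * (\<Prod>j<i. 1 - p ^ (n - j))"
    by (simp add: prod.lessThan_Suc_shift del: prod.lessThan_Suc)
  also have "(\<Prod>j<Suc i. 1 - p ^ Suc j) = (\<Prod>j<i. 1 - p ^ Suc j) * (1 - p ^ Suc i)"
    by (rule prod.lessThan_Suc)
  finally show ?thesis
    by (simp add: gauss_binomial_def prod_dividef mult.commute)
qed

lemma gauss_binomial_pascal:
  fixes p :: "'f::field"
  assumes p: "\<And>k. p ^ Suc k \<noteq> 1"
  shows "gauss_binomial p (Suc n) (Suc i) =
           gauss_binomial p n i + p ^ Suc i * gauss_binomial p n (Suc i)"
proof (cases "i \<le> n")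
  case True
  have "p ^ Suc i * p ^ (n - i) = p ^ Suc n"
    using True by (simp flip: power_add)
  moreover have "1 - p ^ Suc i \<noteq> 0"
    using p[of i] by simp
  ultimately have "(1 - p ^ Suc n) / (1 - p ^ Suc i) =
      1 + p ^ Suc i * ((1 - p ^ (n - i)) / (1 - p ^ Suc i))"
    by (simp add: divide_simps right_diff_distrib del: power_Suc)
  then show ?thesis
    by (simp only: gauss_binomial_Suc_Suc gauss_binomial_Suc[of p n i] distrib_left mult_1_right
        mult.left_commute)
next
  case False
  then show ?thesis
    by (simp add: gauss_binomial_eq_0)
qed

text \<open>Splitting \<open>x = (x - p\<^sup>i) + p\<^sup>i\<close> in front of the \<open>i\<close>-th term of the expansion of \<open>x\<^sup>n\<close> reproduces
  exactly the two terms of the Pascal recurrence for the expansion of \<open>x\<^bsup>n+1\<^esup>\<close>.\<close>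

lemma cauchy_expansion:
  fixes p x :: "'f::field"
  assumes p: "\<And>k. p ^ Suc k \<noteq> 1"
  shows "(\<Sum>i\<le>n. gauss_binomial p n i * (\<Prod>j<i. x - p ^ j)) = x ^ n"
proof (induction n)
  case 0
  show ?case by simp
next
  case (Suc n)
  let ?P = "\<lambda>i. \<Prod>j<i. x - p ^ j"
  have shift: "1 + (\<Sum>i\<le>n. p ^ Suc i * gauss_binomial p n (Suc i) * ?P (Suc i)) =
      (\<Sum>i\<le>n. p ^ i * gauss_binomial p n i * ?P i)"
  proof -
    have "1 + (\<Sum>i\<le>n. p ^ Suc i * gauss_binomial p n (Suc i) * ?P (Suc i)) =
        (\<Sum>i\<le>Suc n. p ^ i * gauss_binomial p n i * ?P i)"
      by (simp only: sum.atMost_Suc_shift) simp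
    also have "\<dots> = (\<Sum>i\<le>n. p ^ i * gauss_binomial p n i * ?P i)"
      by (simp add: gauss_binomial_eq_0)
    finally show ?thesis .
  qed
  have "(\<Sum>i\<le>Suc n. gauss_binomial p (Suc n) i * ?P i) =
      1 + (\<Sum>i\<le>n. gauss_binomial p (Suc n) (Suc i) * ?P (Suc i))"
    by (simp only: sum.atMost_Suc_shift) simp
  also have "\<dots> = (\<Sum>i\<le>n. gauss_binomial p n i * ?P (Suc i)) +
      (1 + (\<Sum>i\<le>n. p ^ Suc i * gauss_binomial p n (Suc i) * ?P (Suc i)))"
    by (simp only: gauss_binomial_pascal[OF p] distrib_right sum.distrib add_ac)
  also have "\<dots> = (\<Sum>i\<le>n. gauss_binomial p n i * ?P (Suc i) + p ^ i * gauss_binomial p n i * ?P i)"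
    by (simp only: shift sum.distrib)
  also have "\<dots> = x * (\<Sum>i\<le>n. gauss_binomial p n i * ?P i)"
    unfolding sum_distrib_left by (rule sum.cong) (simp_all add: algebra_simps)
  also have "\<dots> = x ^ Suc n"
    by (simp add: Suc.IH)
  finally show ?case .
qed

section \<open>The scalars \<open>t\<^sub>i\<close>\<close>

text \<open>With \<open>y = a q\<^bsup>d-2k\<^esup>\<close> the two quotients in \<open>t_pair\<close> are \<open>y q\<^sup>-\<^sup>1 - q y\<^sup>-\<^sup>1\<close> and \<open>y q\<^sup>-\<^sup>1\<close>; the
  cross term \<open>-1\<close> of their product cancels the leading \<open>1\<close>.\<close>

lemma t_pair_monomial:
  fixes q a :: "'f::field"
  assumes q: "q \<noteq> 0" and a: "a \<noteq> 0" and q2: "q ^ 2 \<noteq> 1" and q4: "q ^ 4 \<noteq> 1"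
    and \<theta>: "\<forall>i\<le>d. \<theta> i = a * q powi (int d - 2 * int i) + inverse a * q powi (2 * int i - int d)"
    and k: "Suc k \<le> d"
  shows "t_pair q \<theta> k (Suc k) = a\<^sup>2 * q powi (2 * int d - 4 * int k - 2)"
proof -
  define y where "y = a * q powi (int d - 2 * int k)"
  have y: "y \<noteq> 0" using q a by (simp add: y_def)
  have 0: "\<theta> k = y + inverse y"
    using \<theta> k by (simp add: y_def power_int_minus[symmetric])
  have "q powi (int d - 2 * int (Suc k)) = q powi (int d - 2 * int k) / q\<^sup>2"
    using q by (simp add: algebra_simps power_int_diff power_int_add power2_eq_square)
  moreover have "q powi (2 * int (Suc k) - int d) = q\<^sup>2 / q powi (int d - 2 * int k)"
    using q by (simp add: algebra_simps power_int_diff power_int_add power2_eq_square)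
  moreover have "\<theta> (Suc k) = a * q powi (int d - 2 * int (Suc k))
      + inverse a * q powi (2 * int (Suc k) - int d)"
    using \<theta> k by blast
  ultimately have 1: "\<theta> (Suc k) = y / q\<^sup>2 + q\<^sup>2 / y"
    by (simp add: y_def divide_inverse mult_ac)
  have nz: "q - inverse q \<noteq> 0" "q\<^sup>2 - inverse (q\<^sup>2) \<noteq> 0"
    using q q2 q4 by (auto simp: field_simps power2_eq_square power4_eq_xxxx)
  have "\<theta> k - \<theta> (Suc k) = (q - inverse q) * (y / q - q / y)"
    unfolding 0 1 using q y by (simp add: field_simps power2_eq_square)
  moreover have "q * \<theta> k - inverse q * \<theta> (Suc k) = (q\<^sup>2 - inverse (q\<^sup>2)) * (y / q)"
    unfolding 0 1 using q y by (simp add: field_simps power2_eq_square)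
  ultimately have "t_pair q \<theta> k (Suc k) = 1 + (y / q - q / y) * (y / q)"
    unfolding t_pair_def using nz by simp
  also have "\<dots> = y\<^sup>2 / q\<^sup>2"
    using q y by (simp add: field_simps power2_eq_square)
  also have "\<dots> = a\<^sup>2 * (q powi (int d - 2 * int k) * q powi (int d - 2 * int k) / q powi 2)"
    by (simp add: y_def power_mult_distrib power2_eq_square)
  also have "q powi (int d - 2 * int k) * q powi (int d - 2 * int k) / q powi 2 =
      q powi ((int d - 2 * int k) + (int d - 2 * int k) - 2)"
    using q by (simp only: power_int_add power_int_diff simp_thms)
  also have "(int d - 2 * int k) + (int d - 2 * int k) - 2 = 2 * int d - 4 * int k - 2"
    by simp
  finally show ?thesis .
qed

lemma t_scalar_monomial:
  fixes q a :: "'f::field"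
  assumes q: "q \<noteq> 0" and a: "a \<noteq> 0" and q2: "q ^ 2 \<noteq> 1" and q4: "q ^ 4 \<noteq> 1"
    and \<theta>: "\<forall>i\<le>d. \<theta> i = a * q powi (int d - 2 * int i) + inverse a * q powi (2 * int i - int d)"
  shows "s \<le> d \<Longrightarrow> t_scalar q \<theta> s = a ^ (2 * s) * q powi (2 * int s * (int d - int s))"
proof (induction s)
  case 0
  show ?case by (simp add: t_scalar_def)
next
  case (Suc s)
  have "t_scalar q \<theta> (Suc s) = t_scalar q \<theta> s * t_pair q \<theta> s (Suc s)"
    by (simp add: t_scalar_def)
  also have "\<dots> = a ^ (2 * Suc s) *
      (q powi (2 * int s * (int d - int s)) * q powi (2 * int d - 4 * int s - 2))"
    using Suc by (simp add: t_pair_monomial[OF q a q2 q4 \<theta>] power2_eq_square)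
  also have "q powi (2 * int s * (int d - int s)) * q powi (2 * int d - 4 * int s - 2) =
      q powi (2 * int (Suc s) * (int d - int (Suc s)))"
    using q by (simp add: algebra_simps flip: power_int_add)
  finally show ?case .
qed

lemma t_scalar_ratio:
  fixes q a :: "'f::field"
  assumes q: "q \<noteq> 0" and a: "a \<noteq> 0" and q2: "q ^ 2 \<noteq> 1" and q4: "q ^ 4 \<noteq> 1"
    and \<theta>: "\<forall>i\<le>d. \<theta> i = a * q powi (int d - 2 * int i) + inverse a * q powi (2 * int i - int d)"
    and r: "r \<le> s" and s: "s \<le> d"
  shows "t_scalar q \<theta> s / t_scalar q \<theta> r =
           (a\<^sup>2 * q powi (2 * (int d - int r - int s))) ^ (s - r)"
proof -
  have "t_scalar q \<theta> s / t_scalar q \<theta> r = a ^ (2 * s) / a ^ (2 * r) *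
      (q powi (2 * int s * (int d - int s)) / q powi (2 * int r * (int d - int r)))"
    using r s by (simp add: t_scalar_monomial[OF q a q2 q4 \<theta>])
  also have "a ^ (2 * s) / a ^ (2 * r) = (a\<^sup>2) ^ (s - r)"
    using a r by (simp add: power_diff power_mult)
  also have "q powi (2 * int s * (int d - int s)) / q powi (2 * int r * (int d - int r)) =
      q powi (2 * (int d - int r - int s) * int (s - r))"
    using q r by (simp add: algebra_simps of_nat_diff flip: power_int_diff)
  also have "\<dots> = (q powi (2 * (int d - int r - int s))) ^ (s - r)"
    by (simp only: power_int_mult power_int_of_nat)
  finally show ?thesis
    by (simp add: power_mult_distrib)
qed

section \<open>Evaluation of the sums\<close>

text \<open>This is the common source of both identities. It is stated with the value of \<open>t\<^sub>s / t\<^sub>r\<close> instead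
  of \<open>t\<^sub>s / t\<^sub>r\<close> itself because \<open>t_scalar\<close> is not symmetric under \<open>q \<mapsto> q\<^sup>-\<^sup>1\<close>, whereas the
  hypothesis on \<open>\<theta>\<close> is symmetric under inversion of both parameters.\<close>

lemma theta_sum:
  fixes q a :: "'f::field"
  assumes q: "q \<noteq> 0" and qn: "\<forall>n\<ge>1. q ^ n \<noteq> 1" and a: "a \<noteq> 0"
    and \<theta>: "\<forall>i\<le>d. \<theta> i = a * q powi (int d - 2 * int i) + inverse a * q powi (2 * int i - int d)"
    and r: "r \<le> s" and s: "s \<le> d"
  shows "(\<Sum>i=0..s - r. a ^ i * q powi (int i * (int d - 2 * int r))
            * (\<Prod>j<i. \<theta> s - \<theta> (r + j)) / qpoch (q\<^sup>2) (q\<^sup>2) i) =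
         (a\<^sup>2 * q powi (2 * (int d - int r - int s))) ^ (s - r)"
proof -
  define p where "p = q\<^sup>2"
  define n where "n = s - r"
  define b where "b = a * q powi (int d - 2 * int r)"
  define x where "x = a\<^sup>2 * q powi (2 * (int d - int r - int s))"
  have p0: "p \<noteq> 0" and b0: "b \<noteq> 0"
    using q a by (simp_all add: p_def b_def)
  have p: "p ^ Suc k \<noteq> 1" for k
  proof -
    have "q ^ (2 * Suc k) \<noteq> 1" by (rule qn[rule_format]) simp
    then show ?thesis unfolding p_def power_mult .
  qed
  have \<theta>b: "\<theta> (r + j) = b / p ^ j + p ^ j / b" if "r + j \<le> d" for j
  proof -
    have pj: "p ^ j = q powi (2 * int j)"
      by (simp add: p_def power_int_mult)
    have "q powi (int d - 2 * int (r + j)) = q powi (int d - 2 * int r) / p ^ j"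
      unfolding pj using q by (simp add: algebra_simps flip: power_int_diff)
    moreover have "q powi (2 * int (r + j) - int d) = p ^ j / q powi (int d - 2 * int r)"
      unfolding pj using q by (simp add: algebra_simps flip: power_int_diff)
    moreover have "\<theta> (r + j) = a * q powi (int d - 2 * int (r + j))
        + inverse a * q powi (2 * int (r + j) - int d)"
      using \<theta> that by blast
    ultimately show ?thesis
      by (simp add: b_def divide_inverse mult_ac)
  qed
  have x: "x = b\<^sup>2 / p ^ n"
  proof -
    have "b\<^sup>2 / p ^ n = a\<^sup>2 * (q powi (int d - 2 * int r) * q powi (int d - 2 * int r)
        / q powi (2 * int n))"
      by (simp add: b_def p_def power_mult_distrib power2_eq_square power_int_mult)
    also have "q powi (int d - 2 * int r) * q powi (int d - 2 * int r) / q powi (2 * int n) =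
        q powi (2 * (int d - int r - int s))"
      using q r by (simp add: n_def of_nat_diff algebra_simps flip: power_int_add power_int_diff)
    finally show ?thesis by (simp add: x_def)
  qed
  have factor: "b * (\<theta> s - \<theta> (r + j)) = (1 - p ^ (n - j)) * (x - p ^ j)" if "j \<le> n" for j
  proof -
    have s_eq: "\<theta> s = b / p ^ n + p ^ n / b" and j_eq: "\<theta> (r + j) = b / p ^ j + p ^ j / b"
      using \<theta>b[of n] \<theta>b[of j] r s that by (simp_all add: n_def)
    have n_eq: "p ^ n = p ^ j * p ^ (n - j)"
      using that by (simp flip: power_add)
    show ?thesis
      unfolding s_eq j_eq x n_eq using p0 b0 by (simp add: field_simps power2_eq_square)
  qed
  have summand: "a ^ i * q powi (int i * (int d - 2 * int r)) * (\<Prod>j<i. \<theta> s - \<theta> (r + j))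
      / qpoch (q\<^sup>2) (q\<^sup>2) i = gauss_binomial p n i * (\<Prod>j<i. x - p ^ j)" if "i \<le> n" for i
  proof -
    have "q powi (int i * (int d - 2 * int r)) = (q powi (int d - 2 * int r)) ^ i"
      by (subst mult.commute) (simp only: power_int_mult power_int_of_nat)
    then have "a ^ i * q powi (int i * (int d - 2 * int r)) * (\<Prod>j<i. \<theta> s - \<theta> (r + j)) =
        (\<Prod>j<i. b * (\<theta> s - \<theta> (r + j)))"
      by (simp add: b_def prod.distrib power_mult_distrib)
    also have "\<dots> = (\<Prod>j<i. 1 - p ^ (n - j)) * (\<Prod>j<i. x - p ^ j)"
      unfolding prod.distrib[symmetric] using that by (intro prod.cong refl factor) simp
    finally show ?thesis
      by (simp add: gauss_binomial_def prod_dividef qpoch_def p_def)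
  qed
  have "(\<Sum>i=0..n. a ^ i * q powi (int i * (int d - 2 * int r))
            * (\<Prod>j<i. \<theta> s - \<theta> (r + j)) / qpoch (q\<^sup>2) (q\<^sup>2) i) =
        (\<Sum>i\<le>n. gauss_binomial p n i * (\<Prod>j<i. x - p ^ j))"
    unfolding atLeast0AtMost by (intro sum.cong refl summand) simp
  also have "\<dots> = x ^ n"
    by (rule cauchy_expansion[OF p])
  finally show ?thesis
    by (simp only: n_def x_def)
qed

theorem lemma3p16:
  fixes q a :: "'f::field"
    and scale :: "'f \<Rightarrow> 'v::ab_group_add \<Rightarrow> 'v"
    and act :: "'f free_alg set \<Rightarrow> 'v \<Rightarrow> 'v"
    and \<theta> :: "nat \<Rightarrow> 'f"
    and d r s :: nat
  assumes q_nonzero: "q \<noteq> 0"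
    and q_not_root_of_unity: "\<forall>n\<ge>1. q ^ n \<noteq> 1"
    and V_module: "Oq_module scale q act"
    and V_irreducible: "Oq_module.irreducible_module scale q act"
    and V_finite_dim: "vector_space.finite_dim scale"
    and V_dim: "vector_space.dim scale UNIV \<ge> 2"
    and A_diagonalizable: "vector_space.diagonalizable scale (act (Oq_A q))"
    and Astar_diagonalizable: "vector_space.diagonalizable scale (act (Oq_Astar q))"
    and d_ge_1: "d \<ge> 1"
    and \<theta>_distinct: "inj_on \<theta> {0..d}"
    and \<theta>_eigenvalues: "\<theta> ` {0..d} = vector_space.eigenvalues scale (act (Oq_A q))"
    and a_nonzero: "a \<noteq> 0"
    and \<theta>_form: "\<forall>i\<le>d. \<theta> i = a * q powi (int d - 2 * int i)
                              + inverse a * q powi (2 * int i - int d)"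
    and r_le_s: "r \<le> s"
    and s_le_d: "s \<le> d"
  shows "t_scalar q \<theta> s / t_scalar q \<theta> r =
           (\<Sum>i=0..s - r. a ^ i * q powi (int i * (int d - 2 * int r))
              * (\<Prod>j<i. \<theta> s - \<theta> (r + j)) / qpoch (q\<^sup>2) (q\<^sup>2) i)
       \<and> t_scalar q \<theta> r / t_scalar q \<theta> s =
           (\<Sum>i=0..s - r. a powi (- int i) * q powi (int i * (2 * int r - int d))
              * (\<Prod>j<i. \<theta> s - \<theta> (r + j)) / qpoch (inverse (q\<^sup>2)) (inverse (q\<^sup>2)) i)"
proof
  note ratio = t_scalar_ratio[OF q_nonzero a_nonzero _ _ \<theta>_form r_le_s s_le_d]
  have q24: "q ^ 2 \<noteq> 1" "q ^ 4 \<noteq> 1"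
    using q_not_root_of_unity by simp_all
  show "t_scalar q \<theta> s / t_scalar q \<theta> r =
      (\<Sum>i=0..s - r. a ^ i * q powi (int i * (int d - 2 * int r))
         * (\<Prod>j<i. \<theta> s - \<theta> (r + j)) / qpoch (q\<^sup>2) (q\<^sup>2) i)"
    using ratio[OF q24]
      theta_sum[OF q_nonzero q_not_root_of_unity a_nonzero \<theta>_form r_le_s s_le_d] by simp
  have inv_powi: "inverse q powi m = q powi (- m)" for m
    by (simp add: power_int_minus power_int_inverse)
  have q_inv: "\<forall>n\<ge>1. inverse q ^ n \<noteq> 1"
    using q_not_root_of_unity by (simp add: power_inverse inverse_eq_1_iff)
  have \<theta>_inv: "\<forall>i\<le>d. \<theta> i = inverse a * inverse q powi (int d - 2 * int i)
      + inverse (inverse a) * inverse q powi (2 * int i - int d)"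
    using \<theta>_form by (simp add: inv_powi add.commute)
  have "t_scalar q \<theta> r / t_scalar q \<theta> s = inverse (t_scalar q \<theta> s / t_scalar q \<theta> r)"
    by simp
  also have "\<dots> = ((inverse a)\<^sup>2 * inverse q powi (2 * (int d - int r - int s))) ^ (s - r)"
    unfolding ratio[OF q24] by (simp add: power_inverse power_int_inverse flip: inverse_mult_distrib)
  also have "\<dots> = (\<Sum>i=0..s - r. inverse a ^ i * inverse q powi (int i * (int d - 2 * int r))
      * (\<Prod>j<i. \<theta> s - \<theta> (r + j)) / qpoch ((inverse q)\<^sup>2) ((inverse q)\<^sup>2) i)"
    using theta_sum[OF _ q_inv _ \<theta>_inv r_le_s s_le_d] q_nonzero a_nonzero by simp
  also have "\<dots> = (\<Sum>i=0..s - r. a powi (- int i) * q powi (int i * (2 * int r - int d))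
      * (\<Prod>j<i. \<theta> s - \<theta> (r + j)) / qpoch (inverse (q\<^sup>2)) (inverse (q\<^sup>2)) i)"
    by (simp add: inv_powi power_inverse power_int_minus algebra_simps)
  finally show "t_scalar q \<theta> r / t_scalar q \<theta> s =
      (\<Sum>i=0..s - r. a powi (- int i) * q powi (int i * (2 * int r - int d))
         * (\<Prod>j<i. \<theta> s - \<theta> (r + j)) / qpoch (inverse (q\<^sup>2)) (inverse (q\<^sup>2)) i)" .
qed

end
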